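(* The space-time average $$\langle f(x^{i},t)\rangle_{ST}=\frac{1}{TV_S}\int_{T}\int_{S} f(x^{i}+x'^{i},t+t')\,dt'\,dV'$$ is a linear averaging procedure: for any cosmological fluid fields $f,h$ and constants $a,b$, $$\langle af(x^{i},t)+bh(x^{i},t)\rangle_{ST}=a\langle f(x^{i},t)\rangle_{ST}+b\langle h(x^{i},t)\rangle_{ST}.$$ If a covering by the averaging time intervals $T$ and the space regions $S$ (as defined in the context) is determined through the cosmological fluid configuration, then: (1* ) the space-time average field $\langle f(x^{i},t)\rangle_{ST}$ is a local single-valued function of the reference time $t$ and the position $\{x^k\}$, which depends on the value of $T$ and $V_S$ as parameters, such that $$\Big(\frac{\partial}{\partial x^{i}}\frac{\partial}{\partial t}-\frac{\partial}{\partial t}\frac{\partial}{\partial x^{i}}\Big)\langle f(x^{k},t)\rangle_{ST}=0,\qquad \Big(\frac{\partial}{\partial x^{i}}\frac{\partial}{\partial x^{j}}-\frac{\partial}{\partial x^{j}}\frac{\partial}{\partial x^{i}}\Big)\langle f(x^{k},t)\rangle_{ST}=0;$$ (2* ) the space-time averaging commutes with partial differentiation: $$\frac{\partial}{\partial t}\langle f(x^{k},t)\rangle_{ST}=\Big\langle\frac{\partial}{\partial t}f(x^{k},t)\Big\rangle_{ST},\qquad \frac{\partial}{\partial x^{i}}\langle f(x^{k},t)\rangle_{ST}=\Big\langle\frac{\partial}{\partial x^{i}}f(x^{k},t)\Big\rangle_{ST}.$$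
   Context: $E^3$ is three-dimensional Euclidean space with Cartesian coordinates $x^i$, $i=1,2,3$, and $t$ is the absolute time. A cosmological fluid field is a function $f=f(x^i,t)$ characterizing the fluid. $T$ denotes a measurement (averaging) time interval and also its length; $S\subset E^3$ is a space region (determined by the resolution of the measurement device) with volume $V_S=\int_S dV$. The average is prescribed to the reference point $(x^i,t)$. A covering means that a time interval $T$ and a space region $S$ are prescribed at every moment of time $t$ and every position $\{x^k\}$, and that they are all of the same shape and volume, $T=\mathrm{const}$ and $V_S=\mathrm{const}$, so that $\partial T/\partial t=0$, $\partial T/\partial x^i=0$, $\partial V_S/\partial t=0$, $\partial V_S/\partial x^i=0$.
   Formalization: Fluid fields are assumed continuous for linearity, C^2 for (1* ) and C^1 for (2* ), as averages or derivatives may otherwise not exist; time intervals and regions are bounded; "same shape" in a covering means translates carried along with the reference point, since rotating regions would falsify (2* ). *)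

theory Defs
  imports "HOL-Analysis.Analysis"
begin

type_synonym position = "real^3"
type_synonym field = "position \<Rightarrow> real \<Rightarrow> real"

definition deriv_time :: "field \<Rightarrow> field" where
  "deriv_time f x t = deriv (\<lambda>s. f x s) t"

definition deriv_space :: "3 \<Rightarrow> field \<Rightarrow> field" where
  "deriv_space i f x t = deriv (\<lambda>s. f (x + s *\<^sub>R axis i 1) t) 0"

text \<open>The constant \<^const>\<open>deriv\<close> is total, so existence of the partial derivatives is a
  separate property.\<close>

definition partially_differentiable :: "field \<Rightarrow> bool" where
  "partially_differentiable f \<longleftrightarrow>
     (\<forall>x t. (\<lambda>s. f x s) differentiable (at t)) \<and>
     (\<forall>i x t. (\<lambda>s. f (x + s *\<^sub>R axis i 1) t) differentiable (at 0))"

text \<open>Fields of class \<open>C\<^sup>k\<close> in the four variables jointly.\<close>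

primrec C_field :: "nat \<Rightarrow> field \<Rightarrow> bool" where
  "C_field 0 f \<longleftrightarrow> continuous_on UNIV (\<lambda>(x, t). f x t)"
| "C_field (Suc k) f \<longleftrightarrow>
     continuous_on UNIV (\<lambda>(x, t). f x t) \<and> partially_differentiable f \<and>
     C_field k (deriv_time f) \<and> (\<forall>i. C_field k (deriv_space i f))"

text \<open>\<open>T x t\<close> and \<open>S x t\<close> are the time interval and the space region prescribed at the
  reference point \<open>(x, t)\<close>, as subsets of the time axis and of \<open>E\<^sup>3\<close> in absolute coordinates.
  Intervals may be open, closed or half-open; regions need not be connected.\<close>

definition averaging_cells ::
    "(position \<Rightarrow> real \<Rightarrow> real set) \<Rightarrow> (position \<Rightarrow> real \<Rightarrow> position set) \<Rightarrow> bool" where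
  "averaging_cells T S \<longleftrightarrow>
     (\<forall>x t. is_interval (T x t) \<and> bounded (T x t) \<and> measure lebesgue (T x t) > 0 \<and>
            S x t \<in> sets lebesgue \<and> bounded (S x t) \<and> measure lebesgue (S x t) > 0)"

text \<open>The primed integration variables are displacements from the reference point, hence they
  range over the cell translated back by \<open>(x, t)\<close>.\<close>

definition st_average ::
    "(position \<Rightarrow> real \<Rightarrow> real set) \<Rightarrow> (position \<Rightarrow> real \<Rightarrow> position set) \<Rightarrow> field \<Rightarrow> field" where
  "st_average T S f x t =
     1 / (measure lebesgue (T x t) * measure lebesgue (S x t)) *
     (LINT t':{t'. t + t' \<in> T x t}|lebesgue.
        (LINT x':{x'. x + x' \<in> S x t}|lebesgue. f (x + x') (t + t')))"

text \<open>Having the same shape means that the cell at one reference point is carried to the cell at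
  another by the translation between the reference points; rotations are excluded, since the
  average does not commute with differentiation if the cells turn from point to point. The
  constancy of length and volume follows from the other two clauses.\<close>

definition covering ::
    "(position \<Rightarrow> real \<Rightarrow> real set) \<Rightarrow> (position \<Rightarrow> real \<Rightarrow> position set) \<Rightarrow> bool" where
  "covering T S \<longleftrightarrow> averaging_cells T S \<and>
     (\<forall>x t y s. T y s = (\<lambda>r. r + (s - t)) ` T x t \<and>
                S y s = (\<lambda>z. z + (y - x)) ` S x t \<and>
                measure lebesgue (T y s) = measure lebesgue (T x t) \<and>
                measure lebesgue (S y s) = measure lebesgue (S x t))"

end

theory Submission
  imports Defs
begin

text \<open>A covering prescribes at every reference point a translate of one fixed bounded cell, so the
  average is an integral over displacements in a fixed set and depends on the reference point only
  through the integrand. A partial derivative is a directional derivative in space-time; it passes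
  under both integrals by dominated convergence, the mean value theorem bounding the difference
  quotients by the continuous derivative on a compact set. The mixed derivatives of the average are
  therefore averages of the mixed derivatives of the field, which agree by Schwarz's theorem.\<close>

text \<open>With \<open>v = (0, 1)\<close> or \<open>v = (axis i 1, 0)\<close> this covers the time
  and the space derivatives by one notion, so that each argument is made once. All base points are
  included so that derivatives may be iterated.\<close>

definition has_dir_deriv ::
    "('a::real_normed_vector \<Rightarrow> real) \<Rightarrow> 'a \<Rightarrow> ('a \<Rightarrow> real) \<Rightarrow> bool" where
  "has_dir_deriv F v F' \<longleftrightarrow>
     (\<forall>p. ((\<lambda>s. F (p + s *\<^sub>R v)) has_real_derivative F' p) (at 0))"

text \<open>Every base point is allowed in \<open>has_dir_deriv\<close>, so moving it along the line
  turns the derivative at 0 into one at any parameter, as mean value arguments require.\<close>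

lemma has_dir_deriv_shift:
  assumes "has_dir_deriv F v F'"
  shows "((\<lambda>s. F (p + s *\<^sub>R v)) has_real_derivative F' (p + s *\<^sub>R v)) (at s)"
proof -
  have "((\<lambda>u. F ((p + s *\<^sub>R v) + u *\<^sub>R v)) has_real_derivative F' (p + s *\<^sub>R v)) (at 0)"
    using assms by (simp add: has_dir_deriv_def)
  moreover have "(\<lambda>u. F ((p + s *\<^sub>R v) + u *\<^sub>R v)) = (\<lambda>u. F (p + (u + s) *\<^sub>R v))"
    by (simp add: algebra_simps)
  ultimately show ?thesis
    using DERIV_shift[of "\<lambda>s. F (p + s *\<^sub>R v)" "F' (p + s *\<^sub>R v)" 0 s] by simp
qed

subsection \<open>Symmetry of mixed directional derivatives\<close>

text \<open>The mean value theorem is applied twice: along \<open>v\<close> to the increment of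
  \<open>F\<close> by \<open>h *\<^sub>R w\<close>, then along \<open>w\<close> to
  \<open>G\<close>.\<close>

lemma second_difference_mean_value:
  assumes F: "has_dir_deriv F v G" and G: "has_dir_deriv G w H" and h: "0 < h"
  shows "\<exists>\<xi> \<eta>. 0 < \<xi> \<and> \<xi> < h \<and> 0 < \<eta> \<and> \<eta> < h \<and>
    F (p + h *\<^sub>R v + h *\<^sub>R w) - F (p + h *\<^sub>R w) - F (p + h *\<^sub>R v) + F p
      = h\<^sup>2 * H (p + \<xi> *\<^sub>R v + \<eta> *\<^sub>R w)"
proof -
  \<comment> \<open>The second difference is \<open>?\<phi> h - ?\<phi> 0\<close>.\<close>
  let ?\<phi> = "\<lambda>s. F ((p + h *\<^sub>R w) + s *\<^sub>R v) - F (p + s *\<^sub>R v)"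
  have "DERIV ?\<phi> s :> G ((p + h *\<^sub>R w) + s *\<^sub>R v) - G (p + s *\<^sub>R v)" for s
    by (intro DERIV_diff has_dir_deriv_shift[OF F])
  from MVT2[OF h this] obtain \<xi> where \<xi>: "0 < \<xi>" "\<xi> < h"
    "?\<phi> h - ?\<phi> 0 = (h - 0) * (G ((p + h *\<^sub>R w) + \<xi> *\<^sub>R v) - G (p + \<xi> *\<^sub>R v))" by blast
  let ?\<psi> = "\<lambda>r. G ((p + \<xi> *\<^sub>R v) + r *\<^sub>R w)"
  have "DERIV ?\<psi> r :> H ((p + \<xi> *\<^sub>R v) + r *\<^sub>R w)" for r
    by (rule has_dir_deriv_shift[OF G])
  from MVT2[OF h this] obtain \<eta> where \<eta>: "0 < \<eta>" "\<eta> < h"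
    "?\<psi> h - ?\<psi> 0 = (h - 0) * H ((p + \<xi> *\<^sub>R v) + \<eta> *\<^sub>R w)" by blast
  have "?\<phi> h - ?\<phi> 0 = h * (h * H ((p + \<xi> *\<^sub>R v) + \<eta> *\<^sub>R w))"
    using \<xi>(3) \<eta>(3) by (simp add: add.assoc add.commute add.left_commute)
  then show ?thesis
    using \<xi> \<eta> by (intro exI[of _ \<xi>] exI[of _ \<eta>])
      (simp add: power2_eq_square algebra_simps)
qed

text \<open>The second difference is symmetric in \<open>v\<close> and \<open>w\<close>, so it
  equals \<open>h\<^sup>2\<close> times either mixed derivative at points near \<open>p\<close>.
  After division, \<open>h\<close> tends to 0 and continuity gives equality at
  \<open>p\<close>.\<close>

lemma mixed_dir_deriv_commute:
  assumes "has_dir_deriv F v Fv" "has_dir_deriv Fv w Fvw"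
    and "has_dir_deriv F w Fw" "has_dir_deriv Fw v Fwv"
    and cont: "continuous_on UNIV Fvw" "continuous_on UNIV Fwv"
  shows "Fvw p = Fwv p"
proof -
  define h where "h n = inverse (real (Suc n))" for n
  have h: "0 < h n" for n by (simp add: h_def)
  have h0: "h \<longlonglongrightarrow> 0" unfolding h_def by (rule LIMSEQ_inverse_real_of_nat)
  have "\<forall>n. \<exists>\<xi> \<eta> \<xi>' \<eta>'. 0 < \<xi> \<and> \<xi> < h n \<and> 0 < \<eta> \<and> \<eta> < h n \<and> 0 < \<xi>' \<and> \<xi>' < h n \<and> 0 < \<eta>' \<and> \<eta>' < h n
     \<and> Fvw (p + \<xi> *\<^sub>R v + \<eta> *\<^sub>R w) = Fwv (p + \<xi>' *\<^sub>R w + \<eta>' *\<^sub>R v)"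
  proof
    fix n
    obtain \<xi> \<eta> where 1: "0 < \<xi>" "\<xi> < h n" "0 < \<eta>" "\<eta> < h n"
      "F (p + h n *\<^sub>R v + h n *\<^sub>R w) - F (p + h n *\<^sub>R w) - F (p + h n *\<^sub>R v) + F p
        = (h n)\<^sup>2 * Fvw (p + \<xi> *\<^sub>R v + \<eta> *\<^sub>R w)"
      using second_difference_mean_value[OF assms(1,2) h, where p=p] by blast
    obtain \<xi>' \<eta>' where 2: "0 < \<xi>'" "\<xi>' < h n" "0 < \<eta>'" "\<eta>' < h n"
      "F (p + h n *\<^sub>R w + h n *\<^sub>R v) - F (p + h n *\<^sub>R v) - F (p + h n *\<^sub>R w) + F p
        = (h n)\<^sup>2 * Fwv (p + \<xi>' *\<^sub>R w + \<eta>' *\<^sub>R v)"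
      using second_difference_mean_value[OF assms(3,4) h, where p=p] by blast
    \<comment> \<open>The two second differences agree up to the order of terms and the way this far
      corner is written.\<close>
    have "p + h n *\<^sub>R w + h n *\<^sub>R v = p + h n *\<^sub>R v + h n *\<^sub>R w" by (simp add: algebra_simps)
    from 1(5) 2(5)[unfolded this] have "(h n)\<^sup>2 * Fvw (p + \<xi> *\<^sub>R v + \<eta> *\<^sub>R w) = (h n)\<^sup>2 * Fwv (p + \<xi>' *\<^sub>R w + \<eta>' *\<^sub>R v)"
      by linarith
    then have "Fvw (p + \<xi> *\<^sub>R v + \<eta> *\<^sub>R w) = Fwv (p + \<xi>' *\<^sub>R w + \<eta>' *\<^sub>R v)"
      using h[of n] by auto
    with 1 2 show "\<exists>\<xi> \<eta> \<xi>' \<eta>'. 0 < \<xi> \<and> \<xi> < h n \<and> 0 < \<eta> \<and> \<eta> < h n \<and> 0 < \<xi>' \<and> \<xi>' < h n \<and> 0 < \<eta>' \<and> \<eta>' < h n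
     \<and> Fvw (p + \<xi> *\<^sub>R v + \<eta> *\<^sub>R w) = Fwv (p + \<xi>' *\<^sub>R w + \<eta>' *\<^sub>R v)" by blast
  qed
  then obtain \<xi> \<eta> \<xi>' \<eta>' where *: "\<And>n. 0 < \<xi> n" "\<And>n. \<xi> n < h n" "\<And>n. 0 < \<eta> n" "\<And>n. \<eta> n < h n"
    "\<And>n. 0 < \<xi>' n" "\<And>n. \<xi>' n < h n" "\<And>n. 0 < \<eta>' n" "\<And>n. \<eta>' n < h n"
    and eq: "\<And>n. Fvw (p + \<xi> n *\<^sub>R v + \<eta> n *\<^sub>R w) = Fwv (p + \<xi>' n *\<^sub>R w + \<eta>' n *\<^sub>R v)"
    by metis
  \<comment> \<open>All intermediate parameters are squeezed between 0 and
    \<open>h n\<close>.\<close>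
  have lim0: "z \<longlonglongrightarrow> 0" if "\<And>n. 0 < z n" "\<And>n. z n < h n" for z :: "nat \<Rightarrow> real"
    by (rule tendsto_sandwich[OF _ _ tendsto_const h0])
       (use that in \<open>auto intro!: always_eventually less_imp_le\<close>)
  have lim: "(\<lambda>n. K (p + z n *\<^sub>R a + z' n *\<^sub>R b)) \<longlonglongrightarrow> K p"
    if "continuous_on UNIV K" "z \<longlonglongrightarrow> 0" "z' \<longlonglongrightarrow> 0" for K :: "'a \<Rightarrow> real" and z z' a b
  proof -
    have "(\<lambda>n. p + z n *\<^sub>R a + z' n *\<^sub>R b) \<longlonglongrightarrow> p + 0 *\<^sub>R a + 0 *\<^sub>R b"
      using that(2,3) by (intro tendsto_intros)
    moreover have "isCont K p" using that(1) by (simp add: continuous_on_eq_continuous_at)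
    ultimately show ?thesis using isCont_tendsto_compose[of p K] by simp
  qed
  have "(\<lambda>n. Fvw (p + \<xi> n *\<^sub>R v + \<eta> n *\<^sub>R w)) \<longlonglongrightarrow> Fvw p"
    by (intro lim cont lim0 *)
  moreover have "(\<lambda>n. Fvw (p + \<xi> n *\<^sub>R v + \<eta> n *\<^sub>R w)) \<longlonglongrightarrow> Fwv p"
    unfolding eq by (intro lim cont lim0 *)
  ultimately show ?thesis by (rule LIMSEQ_unique)
qed

subsection \<open>Integrals depending on a parameter\<close>

lemma borel_measurable_indicator_times_continuous:
  fixes g :: "'a::euclidean_space \<Rightarrow> real"
  assumes "A \<in> sets lebesgue" "continuous_on UNIV g"
  shows "(\<lambda>a. indicator A a *\<^sub>R g a) \<in> borel_measurable lebesgue"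
proof -
  have "g \<in> borel_measurable lebesgue"
    using borel_measurable_continuous_onI[OF assms(2)] by (simp add: measurable_completion)
  then show ?thesis using assms(1) by (intro borel_measurable_scaleR borel_measurable_indicator)
qed

text \<open>The closure of a bounded set is compact in Euclidean space, so cells may be open or
  half-open.\<close>

lemma continuous_bounded_on_bounded:
  fixes H :: "'b::euclidean_space \<Rightarrow> real"
  assumes "continuous_on UNIV H" "bounded B"
  obtains M where "\<And>q. q \<in> B \<Longrightarrow> \<bar>H q\<bar> \<le> M"
proof -
  have "compact (H ` closure B)"
    using assms by (intro compact_continuous_image) (auto intro: continuous_on_subset)
  then obtain M where "\<And>q. q \<in> closure B \<Longrightarrow> norm (H q) \<le> M"
    by (metis bounded_iff compact_imp_bounded imageI)
  with closure_subset[of B] that[of M] show ?thesis by auto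
qed

lemma set_integrable_continuous_bounded:
  fixes g :: "'a::euclidean_space \<Rightarrow> real"
  assumes "A \<in> sets lebesgue" "bounded A" "continuous_on UNIV g"
  shows "set_integrable lebesgue A g"
proof -
  obtain M where M: "\<And>a. a \<in> A \<Longrightarrow> \<bar>g a\<bar> \<le> M"
    using continuous_bounded_on_bounded[OF assms(3,2)] by blast
  have "integrable lebesgue (\<lambda>a. indicator A a *\<^sub>R M)"
    using bounded_set_imp_lmeasurable[OF assms(2,1)] by (simp add: lmeasurable_iff_integrable)
  then show ?thesis unfolding set_integrable_def
  proof (rule Bochner_Integration.integrable_bound)
    show "AE a in lebesgue. norm (indicator A a *\<^sub>R g a) \<le> norm (indicator A a *\<^sub>R M)"
      using order_trans[OF M abs_ge_self] by (intro AE_I2) (auto simp: indicator_def)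
  qed (rule borel_measurable_indicator_times_continuous[OF assms(1,3)])
qed

text \<open>Dominated convergence with a constant majorant, integrable because \<open>A\<close> has
  finite measure. It serves both continuity and differentiability under the integral sign.\<close>

lemma tendsto_set_integral_bounded:
  fixes g :: "nat \<Rightarrow> 'a::euclidean_space \<Rightarrow> real"
  assumes A: "A \<in> sets lebesgue" "bounded A"
    and g: "\<And>n. continuous_on UNIV (g n)" "continuous_on UNIV g'"
    and lim: "\<And>a. (\<lambda>n. g n a) \<longlonglongrightarrow> g' a"
    and M: "\<And>n a. a \<in> A \<Longrightarrow> \<bar>g n a\<bar> \<le> M"
  shows "(\<lambda>n. LINT a:A|lebesgue. g n a) \<longlonglongrightarrow> (LINT a:A|lebesgue. g' a)"
  unfolding set_lebesgue_integral_def
proof (rule integral_dominated_convergence)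
  show "integrable lebesgue (\<lambda>a. indicator A a *\<^sub>R M)"
    using bounded_set_imp_lmeasurable[OF A(2,1)] by (simp add: lmeasurable_iff_integrable)
  show "AE a in lebesgue. (\<lambda>n. indicator A a *\<^sub>R g n a) \<longlonglongrightarrow> indicator A a *\<^sub>R g' a"
    by (intro AE_I2 tendsto_intros lim)
  show "AE a in lebesgue. norm (indicator A a *\<^sub>R g n a) \<le> indicator A a *\<^sub>R M" for n
    using M by (intro AE_I2) (auto simp: indicator_def)
qed (rule borel_measurable_indicator_times_continuous[OF A(1)], rule g)+

lemma continuous_on_sections:
  assumes H: "continuous_on UNIV (\<lambda>(p, a). H p a)"
  shows "continuous_on UNIV (H p)" and "continuous_on UNIV (\<lambda>p. H p a)"
  using continuous_on_compose2[OF H continuous_on_Pair[OF continuous_on_const continuous_on_id]]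
    continuous_on_compose2[OF H continuous_on_Pair[OF continuous_on_id continuous_on_const]]
  by simp_all

text \<open>Continuity is tested on sequences: a convergent sequence has bounded range, so
  \<open>H\<close> is bounded on the product of that range with \<open>A\<close>, which yields the
  majorant.\<close>

lemma continuous_on_set_integral_parameter:
  fixes H :: "'p::euclidean_space \<Rightarrow> 'a::euclidean_space \<Rightarrow> real"
  assumes A: "A \<in> sets lebesgue" "bounded A"
    and H: "continuous_on UNIV (\<lambda>(p, a). H p a)"
  shows "continuous_on UNIV (\<lambda>p. LINT a:A|lebesgue. H p a)"
proof -
  have "(\<lambda>n. LINT a:A|lebesgue. H (X n) a) \<longlonglongrightarrow> (LINT a:A|lebesgue. H p a)"
    if X: "X \<longlonglongrightarrow> p" for X p
  proof -
    have "bounded (range X \<times> A)"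
      by (rule bounded_Times[OF convergent_imp_bounded[OF X] A(2)])
    then obtain M where M': "\<And>q. q \<in> range X \<times> A \<Longrightarrow> \<bar>case_prod H q\<bar> \<le> M"
      using continuous_bounded_on_bounded[OF H] by metis
    have M: "\<bar>H (X n) a\<bar> \<le> M" if "a \<in> A" for n a
      using M'[of "(X n, a)"] that by simp
    show ?thesis
    proof (rule tendsto_set_integral_bounded[OF A _ _ _ M])
      show "(\<lambda>n. H (X n) a) \<longlonglongrightarrow> H p a" for a
        using continuous_on_tendsto_compose[OF continuous_on_sections(2)[OF H] X] by simp
    qed (rule continuous_on_sections(1)[OF H])+
  qed
  then show ?thesis by (auto simp: continuous_on_sequentially o_def)
qed

text \<open>Along any null sequence the difference quotients converge pointwise to
  \<open>H' 0 a\<close>; the mean value inequality and continuity of \<open>H'\<close> give a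
  constant majorant.\<close>

lemma has_real_derivative_set_integral:
  fixes H H' :: "real \<Rightarrow> 'a::euclidean_space \<Rightarrow> real"
  assumes A: "A \<in> sets lebesgue" "bounded A"
    and Hc: "\<And>s. continuous_on UNIV (H s)"
    and H': "continuous_on UNIV (\<lambda>(s, a). H' s a)"
    and der: "\<And>s a. ((\<lambda>s. H s a) has_real_derivative H' s a) (at s)"
  shows "((\<lambda>s. LINT a:A|lebesgue. H s a) has_real_derivative (LINT a:A|lebesgue. H' 0 a)) (at 0)"
proof -
  have "(\<lambda>n. ((LINT a:A|lebesgue. H (X n) a) - (LINT a:A|lebesgue. H 0 a)) / X n)
      \<longlonglongrightarrow> (LINT a:A|lebesgue. H' 0 a)"
    if X: "X \<longlonglongrightarrow> 0" and X0: "\<And>n. X n \<noteq> 0" for X :: "nat \<Rightarrow> real"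
  proof -
    \<comment> \<open>The ball of radius \<open>R\<close> contains all \<open>X n\<close>, hence
      also the segments from 0 to them on which the mean value inequality needs \<open>H'\<close>
      bounded.\<close>
    obtain R where R: "\<And>n. \<bar>X n\<bar> \<le> R"
      using convergent_imp_bounded[OF X] by (auto simp: bounded_iff)
    have "bounded (cball 0 R \<times> A)"
      using A(2) by (intro bounded_Times) auto
    then obtain M where M': "\<And>q. q \<in> cball 0 R \<times> A \<Longrightarrow> \<bar>case_prod H' q\<bar> \<le> M"
      using continuous_bounded_on_bounded[OF H'] by metis
    have M: "\<bar>H' s a\<bar> \<le> M" if "\<bar>s\<bar> \<le> R" "a \<in> A" for s a
      using M'[of "(s, a)"] that by simp
    \<comment> \<open>Both integrals exist by continuity, so the quotient may be moved
      inside.\<close>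
    have quot: "((LINT a:A|lebesgue. H (X n) a) - (LINT a:A|lebesgue. H 0 a)) / X n
        = (LINT a:A|lebesgue. (H (X n) a - H 0 a) / X n)" for n
      using A Hc by (simp add: set_integral_diff(2) set_integrable_continuous_bounded)
    show ?thesis unfolding quot
    proof (rule tendsto_set_integral_bounded[OF A])
      show "(\<lambda>n. (H (X n) a - H 0 a) / X n) \<longlonglongrightarrow> H' 0 a" for a
      proof -
        have "((\<lambda>h. (H h a - H 0 a) / h) \<longlongrightarrow> H' 0 a) (at 0)"
          using der[of a 0] by (simp add: DERIV_def)
        then show ?thesis using X X0
          by (auto simp: tendsto_at_iff_sequentially o_def)
      qed
      show "\<bar>(H (X n) a - H 0 a) / X n\<bar> \<le> M" if "a \<in> A" for n a
      proof -
        have "norm (H (X n) a - H 0 a) \<le> M * norm (X n - 0)"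
        proof (rule field_differentiable_bound[where S = "cball 0 R" and f' = "\<lambda>s. H' s a"])
          show "((\<lambda>s. H s a) has_field_derivative H' s a) (at s within cball 0 R)" for s
            by (rule has_field_derivative_at_within[OF der])
        qed (use M[OF _ that] R[of n] in auto)
        then show ?thesis using X0[of n] by (simp add: abs_divide divide_le_eq)
      qed
      show "continuous_on UNIV (\<lambda>a. (H (X n) a - H 0 a) / X n)" for n
        using Hc X0 by (intro continuous_intros) auto
    qed (rule continuous_on_sections(1)[OF H'])
  qed
  then show ?thesis
    unfolding DERIV_def by (auto simp: tendsto_at_iff_sequentially o_def)
qed

subsection \<open>Integrals over translates of a fixed cell\<close>

text \<open>The average without its normalising factor, over a cell of displacements decoupled from
  the reference point \<open>p\<close>. Points are pairs, so a direction may lie in time or in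
  space.\<close>

definition cell_integral ::
    "real set \<Rightarrow> position set \<Rightarrow> (position \<times> real \<Rightarrow> real) \<Rightarrow> position \<times> real \<Rightarrow> real" where
  "cell_integral A B F p = (LINT r:A|lebesgue. (LINT z:B|lebesgue. F (p + (z, r))))"

context
  fixes A :: "real set" and B :: "position set"
  assumes A: "A \<in> sets lebesgue" "bounded A" and B: "B \<in> sets lebesgue" "bounded B"
begin

text \<open>Here \<open>q\<close> joins the reference point and the time displacement; joint
  continuity in both is what the outer integration needs.\<close>

lemma continuous_on_inner_integral:
  fixes F :: "position \<times> real \<Rightarrow> real"
  assumes "continuous_on UNIV F"
  shows "continuous_on UNIV (\<lambda>q. LINT z:B|lebesgue. F (fst q + (z, snd q)))"
proof (rule continuous_on_set_integral_parameter[OF B, where H = "\<lambda>q z. F (fst q + (z, snd q))"])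
  show "continuous_on UNIV (\<lambda>(q :: (position \<times> real) \<times> real, z). F (fst q + (z, snd q)))"
    unfolding case_prod_beta
    by (rule continuous_on_compose2[OF assms]) (auto intro!: continuous_intros)
qed

lemma continuous_on_inner_integral_displacement:
  fixes F :: "position \<times> real \<Rightarrow> real"
  assumes "continuous_on UNIV F"
  shows "continuous_on UNIV (\<lambda>r. LINT z:B|lebesgue. F (p + (z, r)))"
  using continuous_on_compose2[OF continuous_on_inner_integral[OF assms]
      continuous_on_Pair[OF continuous_on_const continuous_on_id]]
  by simp

text \<open>Differentiation under the integral sign is applied over \<open>B\<close> for each fixed
  \<open>r\<close>, then over \<open>A\<close> to the resulting inner integrals.\<close>

lemma has_dir_deriv_cell_integral:
  assumes F: "continuous_on UNIV F" and F': "continuous_on UNIV F'"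
    and der: "has_dir_deriv F v F'"
  shows "has_dir_deriv (cell_integral A B F) v (cell_integral A B F')"
proof -
  let ?I = "\<lambda>F p r. LINT z:B|lebesgue. F (p + (z, r))"
  have inner: "((\<lambda>s. ?I F (p + s *\<^sub>R v) r) has_real_derivative ?I F' p r) (at 0)" for p r
  proof -
    \<comment> \<open>The summand \<open>0 *\<^sub>R v\<close> keeps the shape \<open>H' 0\<close>
      of the parameter lemma.\<close>
    have "((\<lambda>s. LINT z:B|lebesgue. F (p + s *\<^sub>R v + (z, r)))
        has_real_derivative (LINT z:B|lebesgue. F' (p + 0 *\<^sub>R v + (z, r)))) (at 0)"
      using B
    proof (rule has_real_derivative_set_integral[where H = "\<lambda>s z. F (p + s *\<^sub>R v + (z, r))"
          and H' = "\<lambda>s z. F' (p + s *\<^sub>R v + (z, r))"])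
      show "continuous_on UNIV (\<lambda>z. F (p + s *\<^sub>R v + (z, r)))" for s
        by (rule continuous_on_compose2[OF F]) (auto intro!: continuous_intros)
      show "continuous_on UNIV (\<lambda>(s, z). F' (p + s *\<^sub>R v + (z, r)))"
        unfolding case_prod_beta
        by (rule continuous_on_compose2[OF F']) (auto intro!: continuous_intros)
      show "((\<lambda>s. F (p + s *\<^sub>R v + (z, r))) has_real_derivative F' (p + s *\<^sub>R v + (z, r))) (at s)"
        for s z
        using has_dir_deriv_shift[OF der, of "p + (z, r)" s] by (simp add: add_ac)
    qed
    then show ?thesis by simp
  qed
  show ?thesis unfolding has_dir_deriv_def
  proof
    fix p
    have "((\<lambda>s. LINT r:A|lebesgue. ?I F (p + s *\<^sub>R v) r)
        has_real_derivative (LINT r:A|lebesgue. ?I F' (p + 0 *\<^sub>R v) r)) (at 0)"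
      using A
    proof (rule has_real_derivative_set_integral[where H = "\<lambda>s r. ?I F (p + s *\<^sub>R v) r"
          and H' = "\<lambda>s r. ?I F' (p + s *\<^sub>R v) r"])
      show "continuous_on UNIV (\<lambda>r. ?I F (p + s *\<^sub>R v) r)" for s
        by (rule continuous_on_inner_integral_displacement[OF F])
      show "continuous_on UNIV (\<lambda>(s, r). ?I F' (p + s *\<^sub>R v) r)"
      proof -
        have "continuous_on UNIV (\<lambda>q :: real \<times> real. (p + fst q *\<^sub>R v, snd q))"
          by (intro continuous_intros)
        from continuous_on_compose2[OF continuous_on_inner_integral[OF F'] this]
        show ?thesis by (simp add: case_prod_beta)
      qed
      \<comment> \<open>The inner derivative is known at 0 for every base point; the outer
        application needs it at every \<open>s\<close>, which the shift lemma supplies.\<close>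
      have "has_dir_deriv (\<lambda>p. ?I F p r) v (\<lambda>p. ?I F' p r)" for r
        using inner by (simp add: has_dir_deriv_def)
      then show "((\<lambda>s. ?I F (p + s *\<^sub>R v) r) has_real_derivative ?I F' (p + s *\<^sub>R v) r) (at s)" for s r
        by (rule has_dir_deriv_shift)
    qed
    then show "((\<lambda>s. cell_integral A B F (p + s *\<^sub>R v)) has_real_derivative cell_integral A B F' p) (at 0)"
      by (simp add: cell_integral_def)
  qed
qed

text \<open>Additivity of the integral requires integrability; continuity on bounded cells provides
  it, first for the integrands over \<open>B\<close> and then for the inner integrals over
  \<open>A\<close>.\<close>

lemma cell_integral_linear:
  assumes F: "continuous_on UNIV F" and G: "continuous_on UNIV G"
  shows "cell_integral A B (\<lambda>p. a * F p + b * G p) p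
    = a * cell_integral A B F p + b * cell_integral A B G p"
proof -
  have int: "set_integrable lebesgue B (\<lambda>z. K (p + (z, r)))"
    if "continuous_on UNIV K" for K :: "position \<times> real \<Rightarrow> real" and r
    using B by (rule set_integrable_continuous_bounded)
      (auto intro!: continuous_on_compose2[OF that] continuous_intros)
  have "cell_integral A B (\<lambda>p. a * F p + b * G p) p = (LINT r:A|lebesgue.
      a * (LINT z:B|lebesgue. F (p + (z, r))) + b * (LINT z:B|lebesgue. G (p + (z, r))))"
    unfolding cell_integral_def
    by (simp add: set_integral_add(2) int[OF F] int[OF G])
  also have "\<dots> = a * cell_integral A B F p + b * cell_integral A B G p"
    unfolding cell_integral_def
    by (simp add: set_integral_add(2) set_integrable_continuous_bounded[OF A]
        continuous_on_inner_integral_displacement F G)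
  finally show ?thesis .
qed

end

subsection \<open>Fields as functions on space-time\<close>

text \<open>Differentiability makes the values of \<open>deriv\<close> genuine derivatives. Only
  time needs a shift: \<open>deriv_time\<close> differentiates at \<open>t\<close>,
  \<open>deriv_space\<close> at 0.\<close>

lemma partially_differentiable_has_dir_deriv:
  assumes "partially_differentiable f"
  shows "has_dir_deriv (case_prod f) (0, 1) (case_prod (deriv_time f))"
    and "has_dir_deriv (case_prod f) (axis i 1, 0) (case_prod (deriv_space i f))"
proof -
  have "((\<lambda>s. f x (t + s)) has_real_derivative deriv_time f x t) (at 0)" for x t
  proof -
    have "((\<lambda>s. f x s) has_real_derivative deriv_time f x t) (at t)"
      using assms unfolding partially_differentiable_def deriv_time_def
      by (auto simp: DERIV_deriv_iff_real_differentiable)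
    then show ?thesis using DERIV_shift[of "f x" "deriv_time f x t" 0 t] by (simp add: add.commute)
  qed
  then show "has_dir_deriv (case_prod f) (0, 1) (case_prod (deriv_time f))"
    by (auto simp: has_dir_deriv_def)
  show "has_dir_deriv (case_prod f) (axis i 1, 0) (case_prod (deriv_space i f))"
    using assms unfolding partially_differentiable_def has_dir_deriv_def deriv_space_def
    by (auto simp: DERIV_deriv_iff_real_differentiable)
qed

text \<open>The way back from directional derivatives, by uniqueness of the derivative.\<close>

lemma has_dir_deriv_timeD:
  assumes "has_dir_deriv (case_prod f) (0, 1) (case_prod g)"
  shows "(\<lambda>s. f x s) differentiable (at t)" and "deriv_time f = g"
proof -
  \<comment> \<open>Starting from \<open>(x, 0)\<close>, the parameter \<open>t\<close> reaches
    \<open>(x, t)\<close>.\<close>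
  have *: "(f x has_real_derivative g x t) (at t)" for x t
    using has_dir_deriv_shift[OF assms, of "(x, 0)" t] by simp
  then show "(\<lambda>s. f x s) differentiable (at t)"
    by (auto simp: real_differentiable_def)
  show "deriv_time f = g"
    using * by (auto simp: deriv_time_def fun_eq_iff intro: DERIV_imp_deriv)
qed

lemma has_dir_deriv_spaceD:
  assumes "has_dir_deriv (case_prod f) (axis i 1, 0) (case_prod g)"
  shows "(\<lambda>s. f (x + s *\<^sub>R axis i 1) t) differentiable (at 0)" and "deriv_space i f = g"
proof -
  have *: "((\<lambda>s. f (x + s *\<^sub>R axis i 1) t) has_real_derivative g x t) (at 0)" for x t
    using assms[unfolded has_dir_deriv_def, rule_format, of "(x, t)"] by simp
  then show "(\<lambda>s. f (x + s *\<^sub>R axis i 1) t) differentiable (at 0)"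
    by (auto simp: real_differentiable_def)
  show "deriv_space i f = g"
    using * by (auto simp: deriv_space_def fun_eq_iff intro: DERIV_imp_deriv)
qed

lemma C_field_continuous: "C_field k f \<Longrightarrow> continuous_on UNIV (case_prod f)"
  by (cases k) auto

lemma C_field_has_dir_deriv:
  assumes "C_field (Suc k) f"
  shows "has_dir_deriv (case_prod f) (0, 1) (case_prod (deriv_time f))"
    and "has_dir_deriv (case_prod f) (axis i 1, 0) (case_prod (deriv_space i f))"
  using assms partially_differentiable_has_dir_deriv by auto

text \<open>Schwarz's theorem with \<open>v\<close> the time axis and \<open>w\<close> a space axis.
  Class \<open>C_field 2\<close> makes the first derivatives of class 1, so both mixed derivatives
  exist and are continuous.\<close>

lemma deriv_space_deriv_time_commute:
  assumes "C_field 2 f"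
  shows "deriv_space i (deriv_time f) = deriv_time (deriv_space i f)"
proof -
  from assms have f: "C_field (Suc 1) f" by (simp add: numeral_2_eq_2)
  then have t: "C_field (Suc 0) (deriv_time f)" and s: "C_field (Suc 0) (deriv_space i f)"
    by simp_all
  have c: "continuous_on UNIV (case_prod (deriv_space i (deriv_time f)))"
    "continuous_on UNIV (case_prod (deriv_time (deriv_space i f)))"
    using s t by (auto intro: C_field_continuous)
  have "case_prod (deriv_space i (deriv_time f)) p = case_prod (deriv_time (deriv_space i f)) p" for p
    by (rule mixed_dir_deriv_commute[OF C_field_has_dir_deriv(1)[OF f] C_field_has_dir_deriv(2)[OF t]
        C_field_has_dir_deriv(2)[OF f] C_field_has_dir_deriv(1)[OF s] c])
  from this[of "(_, _)"] show ?thesis by (intro ext) simp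
qed

lemma deriv_space_commute:
  assumes "C_field 2 f"
  shows "deriv_space i (deriv_space j f) = deriv_space j (deriv_space i f)"
proof -
  from assms have f: "C_field (Suc 1) f" by (simp add: numeral_2_eq_2)
  then have s: "C_field (Suc 0) (deriv_space k f)" for k
    by simp
  have c: "continuous_on UNIV (case_prod (deriv_space k (deriv_space l f)))" for k l
    using s[of l] by (auto intro: C_field_continuous)
  have "case_prod (deriv_space i (deriv_space j f)) p = case_prod (deriv_space j (deriv_space i f)) p" for p
    by (rule mixed_dir_deriv_commute[OF C_field_has_dir_deriv(2)[OF f] C_field_has_dir_deriv(2)[OF s]
        C_field_has_dir_deriv(2)[OF f] C_field_has_dir_deriv(2)[OF s] c c])
  from this[of "(_, _)"] show ?thesis by (intro ext) simp
qed

subsection \<open>The space-time average\<close>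

text \<open>Measurability of the time cell comes from its being an interval: bounded convex sets are
  measurable.\<close>

lemma averaging_cells_measurable:
  assumes "averaging_cells T S"
  shows "T x t \<in> sets lebesgue" "bounded (T x t)" "S x t \<in> sets lebesgue" "bounded (S x t)"
proof -
  have "is_interval (T x t)" "bounded (T x t)"
    using assms by (simp_all add: averaging_cells_def)
  then have "T x t \<in> lmeasurable" by (simp only: is_interval_convex measurable_convex)
  then show "T x t \<in> sets lebesgue" by (rule fmeasurableD)
qed (use assms in \<open>simp_all add: averaging_cells_def\<close>)

text \<open>Displacements from \<open>c\<close> into \<open>C\<close> form the translate of
  \<open>C\<close> by \<open>- c\<close>, and translation preserves both properties.\<close>

lemma lebesgue_displacements:
  fixes C :: "'a::euclidean_space set"
  assumes "C \<in> sets lebesgue" "bounded C"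
  shows "{z. c + z \<in> C} \<in> sets lebesgue" "bounded {z. c + z \<in> C}"
proof -
  have eq: "{z. c + z \<in> C} = (\<lambda>z. - c + z) ` C"
  proof (intro set_eqI iffI)
    fix z assume "z \<in> {z. c + z \<in> C}"
    then have "- c + (c + z) \<in> (\<lambda>z. - c + z) ` C" by blast
    then show "z \<in> (\<lambda>z. - c + z) ` C" by simp
  qed auto
  show "{z. c + z \<in> C} \<in> sets lebesgue"
    unfolding eq using assms(1) by (rule lebesgue_sets_translation)
  show "bounded {z. c + z \<in> C}"
    unfolding eq using assms(2) by (rule bounded_translation)
qed

lemma st_average_eq_cell_integral:
  "st_average T S f x t = 1 / (measure lebesgue (T x t) * measure lebesgue (S x t)) *
     cell_integral {t'. t + t' \<in> T x t} {x'. x + x' \<in> S x t} (case_prod f) (x, t)"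
  by (simp add: st_average_def cell_integral_def)

text \<open>At one reference point the cell is a fixed set, so linearity of
  \<open>cell_integral\<close> applies to arbitrary averaging cells.\<close>

lemma st_average_linear:
  assumes "averaging_cells T S" "C_field 0 f" "C_field 0 h"
  shows "st_average T S (\<lambda>x t. a * f x t + b * h x t) x t =
          a * st_average T S f x t + b * st_average T S h x t"
proof -
  have m: "T x t \<in> sets lebesgue" "bounded (T x t)" "S x t \<in> sets lebesgue" "bounded (S x t)"
    by (fact averaging_cells_measurable[OF assms(1)])+
  have eq: "case_prod (\<lambda>x t. a * f x t + b * h x t) = (\<lambda>p. a * case_prod f p + b * case_prod h p)"
    by auto
  have scale: "c * (a * u + b * v) = a * (c * u) + b * (c * v)" for c u v :: real
    by (simp add: algebra_simps)
  note lin = cell_integral_linear[OF lebesgue_displacements[OF m(1,2)] lebesgue_displacements[OF m(3,4)]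
      C_field_continuous[OF assms(2)] C_field_continuous[OF assms(3)], of t x a b "(x, t)"]
  show ?thesis
    unfolding st_average_eq_cell_integral eq lin by (rule scale)
qed

text \<open>The indicators in the set integrals confine both variables to the cell, so values of the
  fields elsewhere cannot enter. This is the locality of the average.\<close>

lemma st_average_local:
  assumes "\<forall>y \<in> S x t. \<forall>s \<in> T x t. f y s = g y s"
  shows "st_average T S f x t = st_average T S g x t"
proof -
  have "(LINT t':{t'. t + t' \<in> T x t}|lebesgue. (LINT x':{x'. x + x' \<in> S x t}|lebesgue. f (x + x') (t + t')))
    = (LINT t':{t'. t + t' \<in> T x t}|lebesgue. (LINT x':{x'. x + x' \<in> S x t}|lebesgue. g (x + x') (t + t')))"
    unfolding set_lebesgue_integral_def
    using assms by (intro Bochner_Integration.integral_cong refl) (auto simp: indicator_def intro!: Bochner_Integration.integral_cong)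
  then show ?thesis by (simp add: st_average_def)
qed

section \<open>Averages over a covering: reduction to the cell at the origin\<close>

context
  fixes T S
  assumes cov: "covering T S"
begin

lemma covering_translates:
  "T x t = (\<lambda>t'. t + t') ` T 0 0" "S x t = (\<lambda>x'. x + x') ` S 0 0"
  "measure lebesgue (T x t) = measure lebesgue (T 0 0)"
  "measure lebesgue (S x t) = measure lebesgue (S 0 0)"
proof -
  have "T x t = (\<lambda>r. r + (t - 0)) ` T 0 0" "S x t = (\<lambda>z. z + (x - 0)) ` S 0 0"
    "measure lebesgue (T x t) = measure lebesgue (T 0 0)"
    "measure lebesgue (S x t) = measure lebesgue (S 0 0)"
    using cov unfolding covering_def by blast+
  then show "T x t = (\<lambda>t'. t + t') ` T 0 0" "S x t = (\<lambda>x'. x + x') ` S 0 0"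
    "measure lebesgue (T x t) = measure lebesgue (T 0 0)"
    "measure lebesgue (S x t) = measure lebesgue (S 0 0)"
    by (simp_all add: add.commute)
qed

text \<open>Here the covering does its work: the domain of integration no longer moves with the
  reference point, so differentiation produces no boundary terms.\<close>

lemma covering_displacements:
  "{t'. t + t' \<in> T x t} = T 0 0" "{x'. x + x' \<in> S x t} = S 0 0"
  by (auto simp: covering_translates(1)[of x t] covering_translates(2)[of x t])

lemma covering_cell:
  "T 0 0 \<in> sets lebesgue" "bounded (T 0 0)" "measure lebesgue (T 0 0) > 0"
  "S 0 0 \<in> sets lebesgue" "bounded (S 0 0)" "measure lebesgue (S 0 0) > 0"
proof -
  have cells: "averaging_cells T S" using cov by (simp add: covering_def)
  then show "measure lebesgue (T 0 0) > 0" "measure lebesgue (S 0 0) > 0"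
    by (simp_all add: averaging_cells_def)
  show "T 0 0 \<in> sets lebesgue" "bounded (T 0 0)" "S 0 0 \<in> sets lebesgue" "bounded (S 0 0)"
    by (fact averaging_cells_measurable[OF cells])+
qed

text \<open>The normalising factor is constant too, so the average inherits the derivatives of
  \<open>cell_integral\<close>.\<close>

lemma case_prod_st_average:
  "case_prod (st_average T S f) =
    (\<lambda>p. 1 / (measure lebesgue (T 0 0) * measure lebesgue (S 0 0)) *
      cell_integral (T 0 0) (S 0 0) (case_prod f) p)"
proof
  show "case_prod (st_average T S f) p = 1 / (measure lebesgue (T 0 0) * measure lebesgue (S 0 0)) *
      cell_integral (T 0 0) (S 0 0) (case_prod f) p" for p
  proof -
    obtain x t where p: "p = (x, t)" by (cases p)
    show ?thesis
      by (simp only: p case_prod_conv st_average_eq_cell_integral covering_displacements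
          covering_translates(3,4)[of x t])
  qed
qed

lemma has_dir_deriv_st_average:
  assumes "continuous_on UNIV (case_prod f)" "continuous_on UNIV (case_prod g)"
    and "has_dir_deriv (case_prod f) v (case_prod g)"
  shows "has_dir_deriv (case_prod (st_average T S f)) v (case_prod (st_average T S g))"
  using has_dir_deriv_cell_integral[OF covering_cell(1,2,4,5) assms]
  unfolding case_prod_st_average has_dir_deriv_def by (intro allI DERIV_cmult) blast

text \<open>The equations are between fields rather than at points, so that they can be used under a
  further derivative.\<close>

lemma st_average_derivatives:
  assumes "C_field (Suc k) f"
  shows "partially_differentiable (st_average T S f)"
    and "deriv_time (st_average T S f) = st_average T S (deriv_time f)"
    and "deriv_space i (st_average T S f) = st_average T S (deriv_space i f)"
proof -
  have f: "continuous_on UNIV (case_prod f)" "continuous_on UNIV (case_prod (deriv_time f))"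
    "continuous_on UNIV (case_prod (deriv_space i f))" for i
    using assms by (auto intro: C_field_continuous)
  note t = has_dir_deriv_st_average[OF f(1,2) C_field_has_dir_deriv(1)[OF assms]]
  note s = has_dir_deriv_st_average[OF f(1,3) C_field_has_dir_deriv(2)[OF assms]]
  show "partially_differentiable (st_average T S f)"
    using has_dir_deriv_timeD(1)[OF t] has_dir_deriv_spaceD(1)[OF s]
    by (auto simp: partially_differentiable_def)
  show "deriv_time (st_average T S f) = st_average T S (deriv_time f)"
    by (rule has_dir_deriv_timeD(2)[OF t])
  show "deriv_space i (st_average T S f) = st_average T S (deriv_space i f)"
    by (rule has_dir_deriv_spaceD(2)[OF s])
qed

text \<open>First derivatives of the average are averages of fields of class 1, so the previous
  lemma applies again; mixed derivatives become averages of the mixed derivatives of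
  \<open>f\<close>, which commute.\<close>

lemma st_average_second_derivatives:
  assumes "C_field 2 f"
  shows "partially_differentiable (deriv_time (st_average T S f))"
    and "partially_differentiable (deriv_space i (st_average T S f))"
    and "deriv_space i (deriv_time (st_average T S f)) = deriv_time (deriv_space i (st_average T S f))"
    and "deriv_space i (deriv_space j (st_average T S f)) = deriv_space j (deriv_space i (st_average T S f))"
proof -
  from assms have f: "C_field (Suc 1) f" by (simp add: numeral_2_eq_2)
  then have t: "C_field (Suc 0) (deriv_time f)" and s: "\<And>i. C_field (Suc 0) (deriv_space i f)"
    by simp_all
  \<comment> \<open>These rules move every derivative inside the average.\<close>
  note [simp] = st_average_derivatives(2,3)[OF f] st_average_derivatives(2,3)[OF t]
    st_average_derivatives(2,3)[OF s]
  show "partially_differentiable (deriv_time (st_average T S f))"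
    "partially_differentiable (deriv_space i (st_average T S f))"
    by (simp_all add: st_average_derivatives(1)[OF t] st_average_derivatives(1)[OF s])
  show "deriv_space i (deriv_time (st_average T S f)) = deriv_time (deriv_space i (st_average T S f))"
    by (simp add: deriv_space_deriv_time_commute[OF assms])
  show "deriv_space i (deriv_space j (st_average T S f)) = deriv_space j (deriv_space i (st_average T S f))"
    by (simp add: deriv_space_commute[OF assms, of i j])
qed

lemma st_average_fixed_cell:
  "st_average T S f x t = 1 / (measure lebesgue (T 0 0) * measure lebesgue (S 0 0)) *
     (LINT t':T 0 0|lebesgue. (LINT x':S 0 0|lebesgue. f (x + x') (t + t')))"
  unfolding st_average_def covering_displacements
  by (simp only: covering_translates(3,4)[of x t])

end

theorem theorem1:
  fixes T :: "position \<Rightarrow> real \<Rightarrow> real set" and S :: "position \<Rightarrow> real \<Rightarrow> position set"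
  assumes "averaging_cells T S"
  shows
    "(\<forall>f h a b x t. C_field 0 f \<longrightarrow> C_field 0 h \<longrightarrow>
        st_average T S (\<lambda>x t. a * f x t + b * h x t) x t =
          a * st_average T S f x t + b * st_average T S h x t)
     \<and>
     (covering T S \<longrightarrow>
        (\<exists>\<tau> V T0 S0. \<tau> > 0 \<and> V > 0 \<and>
           (\<forall>x t. T x t = (\<lambda>t'. t + t') ` T0 \<and> measure lebesgue (T x t) = \<tau> \<and>
                  S x t = (\<lambda>x'. x + x') ` S0 \<and> measure lebesgue (S x t) = V) \<and>
           (\<forall>f x t. C_field 0 f \<longrightarrow> st_average T S f x t =
              1 / (\<tau> * V) * (LINT t':T0|lebesgue. (LINT x':S0|lebesgue. f (x + x') (t + t')))))
        \<and>
        (\<forall>f g x t. C_field 0 f \<longrightarrow> C_field 0 g \<longrightarrow>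
           (\<forall>y \<in> S x t. \<forall>s \<in> T x t. f y s = g y s) \<longrightarrow>
           st_average T S f x t = st_average T S g x t)
        \<and>
        (\<forall>f. C_field 2 f \<longrightarrow>
           partially_differentiable (st_average T S f) \<and>
           partially_differentiable (deriv_time (st_average T S f)) \<and>
           (\<forall>i. partially_differentiable (deriv_space i (st_average T S f))) \<and>
           (\<forall>i x t. deriv_space i (deriv_time (st_average T S f)) x t
                    - deriv_time (deriv_space i (st_average T S f)) x t = 0) \<and>
           (\<forall>i j x t. deriv_space i (deriv_space j (st_average T S f)) x t
                      - deriv_space j (deriv_space i (st_average T S f)) x t = 0))
        \<and>
        (\<forall>f. C_field 1 f \<longrightarrow>
           partially_differentiable (st_average T S f) \<and>
           (\<forall>x t. deriv_time (st_average T S f) x t = st_average T S (deriv_time f) x t) \<and>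
           (\<forall>i x t. deriv_space i (st_average T S f) x t = st_average T S (deriv_space i f) x t)))"
proof (intro conjI impI)
  show "\<forall>f h a b x t. C_field 0 f \<longrightarrow> C_field 0 h \<longrightarrow>
      st_average T S (\<lambda>x t. a * f x t + b * h x t) x t =
        a * st_average T S f x t + b * st_average T S h x t"
    using st_average_linear[OF assms] by blast
next
  assume cov: "covering T S"
  note tr = covering_translates[OF cov]
  \<comment> \<open>The witnesses are the length, the volume and the two sets of the cell at the
    origin.\<close>
  show "\<exists>\<tau> V T0 S0. \<tau> > 0 \<and> V > 0 \<and>
     (\<forall>x t. T x t = (\<lambda>t'. t + t') ` T0 \<and> measure lebesgue (T x t) = \<tau> \<and>
            S x t = (\<lambda>x'. x + x') ` S0 \<and> measure lebesgue (S x t) = V) \<and>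
     (\<forall>f x t. C_field 0 f \<longrightarrow> st_average T S f x t =
        1 / (\<tau> * V) * (LINT t':T0|lebesgue. (LINT x':S0|lebesgue. f (x + x') (t + t'))))"
    using covering_cell(3,6)[OF cov] tr st_average_fixed_cell[OF cov]
    by (intro exI[of _ "measure lebesgue (T 0 0)"] exI[of _ "measure lebesgue (S 0 0)"]
        exI[of _ "T 0 0"] exI[of _ "S 0 0"] conjI allI impI)
  show "\<forall>f g x t. C_field 0 f \<longrightarrow> C_field 0 g \<longrightarrow>
      (\<forall>y \<in> S x t. \<forall>s \<in> T x t. f y s = g y s) \<longrightarrow>
      st_average T S f x t = st_average T S g x t"
    using st_average_local by blast
  show "\<forall>f. C_field 2 f \<longrightarrow>
     partially_differentiable (st_average T S f) \<and>
     partially_differentiable (deriv_time (st_average T S f)) \<and>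
     (\<forall>i. partially_differentiable (deriv_space i (st_average T S f))) \<and>
     (\<forall>i x t. deriv_space i (deriv_time (st_average T S f)) x t
              - deriv_time (deriv_space i (st_average T S f)) x t = 0) \<and>
     (\<forall>i j x t. deriv_space i (deriv_space j (st_average T S f)) x t
                - deriv_space j (deriv_space i (st_average T S f)) x t = 0)"
  proof (intro allI impI)
    fix f assume f: "C_field 2 f"
    then have "C_field (Suc 1) f" by (simp add: numeral_2_eq_2)
    note d = st_average_derivatives(1)[OF cov this] st_average_second_derivatives[OF cov f]
    show "partially_differentiable (st_average T S f) \<and>
       partially_differentiable (deriv_time (st_average T S f)) \<and>
       (\<forall>i. partially_differentiable (deriv_space i (st_average T S f))) \<and>
       (\<forall>i x t. deriv_space i (deriv_time (st_average T S f)) x t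
                - deriv_time (deriv_space i (st_average T S f)) x t = 0) \<and>
       (\<forall>i j x t. deriv_space i (deriv_space j (st_average T S f)) x t
                  - deriv_space j (deriv_space i (st_average T S f)) x t = 0)"
    proof (intro conjI allI)
      \<comment> \<open>As a rewrite rule the symmetry in \<open>i\<close> and \<open>j\<close> is
        permutative; with the indices fixed it turns the first term into the second.\<close>
      show "deriv_space i (deriv_space j (st_average T S f)) x t
          - deriv_space j (deriv_space i (st_average T S f)) x t = 0" for i j x t
        unfolding d(5)[of i j] by simp
    qed (simp_all only: d diff_self)
  qed
  show "\<forall>f. C_field 1 f \<longrightarrow>
     partially_differentiable (st_average T S f) \<and>
     (\<forall>x t. deriv_time (st_average T S f) x t = st_average T S (deriv_time f) x t) \<and>
     (\<forall>i x t. deriv_space i (st_average T S f) x t = st_average T S (deriv_space i f) x t)"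
    using st_average_derivatives[OF cov, of 0] by simp
qed

end
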